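(* Let $C$ be a neighbour-transitive code with minimum distance $\delta\geq 3$ in the Kneser graph $K(n,k)$ and suppose that $\mathrm{Aut}(C)$ acts transitively on $\Omega$. Then either $n=2k+1$ (i.e. $K(n,k)$ is an odd graph) or $\mathrm{Aut}(C)$ acts $2$-homogeneously on $\Omega$.
   Context: Let $\Omega$ be a finite set with $|\Omega|=n$ and let $2\leq k\leq (n-1)/2$. The Kneser graph $K(n,k)$ has as vertices the $k$-subsets of $\Omega$, two vertices being adjacent iff they are disjoint; when $n=2k+1$ it is the odd graph $O_{k+1}$. Its automorphism group is $\mathrm{Sym}(\Omega)$. A code $C$ is a set of vertices with $|C|\geq 2$. Writing $d$ for graph distance, the minimum distance $\delta$ of $C$ is the least distance between two distinct codewords; $C_1$ is the set of vertices $\gamma$ with $\min_{\alpha\in C} d(\alpha,\gamma)=1$. $\mathrm{Aut}(C)$ is the setwise stabiliser of $C$ in $\mathrm{Sym}(\Omega)$. $C$ is neighbour-transitive if $C_1\neq\emptyset$ and $\mathrm{Aut}(C)$ is transitive on both $C$ and $C_1$. A group acting on $\Omega$ is $2$-homogeneous if it is transitive on the set of $2$-subsets of $\Omega$. *)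

theory Defs
  imports "HOL-Algebra.Group_Action" "Graph_Theory.Pair_Digraph" "Graph_Theory.Shortest_Path"
begin

definition subsets_of_card :: "'a set \<Rightarrow> nat \<Rightarrow> 'a set set" where
  "subsets_of_card \<Omega> k = {A. A \<subseteq> \<Omega> \<and> card A = k}"

definition kneser :: "'a set \<Rightarrow> nat \<Rightarrow> 'a set pair_pre_digraph" where
  "kneser \<Omega> k =
     \<lparr> pverts = subsets_of_card \<Omega> k,
       parcs = {(A, B). A \<in> subsets_of_card \<Omega> k \<and> B \<in> subsets_of_card \<Omega> k \<and> A \<inter> B = {}} \<rparr>"

(* In particular the hypothesis of the locale in which the library defines walk costs and
   shortest paths is satisfied by Kneser graphs. *)
lemma pair_graph_kneser:
  assumes "finite \<Omega>" "0 < k"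
  shows "pair_graph (kneser \<Omega> k)"
proof -
  have fin: "finite (subsets_of_card \<Omega> k)"
    using assms(1) by (simp add: subsets_of_card_def)
  have "parcs (kneser \<Omega> k) \<subseteq> subsets_of_card \<Omega> k \<times> subsets_of_card \<Omega> k"
    by (auto simp: kneser_def)
  then have fin': "finite (parcs (kneser \<Omega> k))"
    using fin by (meson finite_SigmaI finite_subset)
  show ?thesis
  proof
    show "symmetric (with_proj (kneser \<Omega> k))"
      unfolding symmetric_def with_proj_simps
      by (rule symI) (simp add: kneser_def Int_commute)
    show "fst e \<noteq> snd e" if "e \<in> parcs (kneser \<Omega> k)" for e
    proof
      assume "fst e = snd e"
      with that have "card (fst e) = k" "fst e = {}"
        by (cases e, simp add: kneser_def subsets_of_card_def)+
      with assms(2) show False by simp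
    qed
  qed (use fin fin' in \<open>auto simp: kneser_def\<close>)
qed

(* The least number of arcs of a walk from u to v, and infinity if there is no such walk. *)
definition graph_dist :: "'v pair_pre_digraph \<Rightarrow> 'v \<Rightarrow> 'v \<Rightarrow> ereal" where
  "graph_dist G u v = wf_digraph.\<mu> (with_proj G) (\<lambda>_. 1) u v"

definition is_code :: "'v pair_pre_digraph \<Rightarrow> 'v set \<Rightarrow> bool" where
  "is_code G C \<longleftrightarrow> C \<subseteq> pverts G \<and> 2 \<le> card C"

(* Codes in finite graphs are finite and have two distinct elements, so this infimum and the
   one in the next definition are attained. *)
definition min_distance :: "'v pair_pre_digraph \<Rightarrow> 'v set \<Rightarrow> ereal" where
  "min_distance G C = (INF (\<alpha>, \<beta>) \<in> {(\<alpha>, \<beta>). \<alpha> \<in> C \<and> \<beta> \<in> C \<and> \<alpha> \<noteq> \<beta>}. graph_dist G \<alpha> \<beta>)"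

definition code_neighbours :: "'v pair_pre_digraph \<Rightarrow> 'v set \<Rightarrow> 'v set" where
  "code_neighbours G C = {\<gamma> \<in> pverts G. (INF \<alpha>\<in>C. graph_dist G \<alpha> \<gamma>) = 1}"

definition code_aut :: "'a set \<Rightarrow> 'a set set \<Rightarrow> ('a \<Rightarrow> 'a) monoid" where
  "code_aut \<Omega> C = (BijGroup \<Omega>)\<lparr>carrier := stabilizer (BijGroup \<Omega>) (\<lambda>g D. (`) g ` D) C\<rparr>"

(* BijGroup consists of extensional functions, hence the restriction to X. *)
definition transitive_on_sets :: "('a \<Rightarrow> 'a) monoid \<Rightarrow> 'a set set \<Rightarrow> bool" where
  "transitive_on_sets G X \<longleftrightarrow> transitive_action G X (\<lambda>g. \<lambda>A\<in>X. g ` A)"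

definition transitive_on_points :: "('a \<Rightarrow> 'a) monoid \<Rightarrow> 'a set \<Rightarrow> bool" where
  "transitive_on_points G \<Omega> \<longleftrightarrow> transitive_action G \<Omega> (\<lambda>g. g)"

definition two_homogeneous :: "('a \<Rightarrow> 'a) monoid \<Rightarrow> 'a set \<Rightarrow> bool" where
  "two_homogeneous G \<Omega> \<longleftrightarrow> transitive_on_sets G (subsets_of_card \<Omega> 2)"

definition neighbour_transitive :: "'a set \<Rightarrow> nat \<Rightarrow> 'a set set \<Rightarrow> bool" where
  "neighbour_transitive \<Omega> k C \<longleftrightarrow>
     is_code (kneser \<Omega> k) C \<and>
     code_neighbours (kneser \<Omega> k) C \<noteq> {} \<and>
     transitive_on_sets (code_aut \<Omega> C) C \<and>
     transitive_on_sets (code_aut \<Omega> C) (code_neighbours (kneser \<Omega> k) C)"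

end

(* Let P be an orbit of Aut(C) on pairs of points, viewed as the edge set of a graph.  Since the
   codewords are pairwise non-adjacent, every k-subset of the complement of a codeword lies in C_1,
   and by transitivity on C_1 all of these span equally many edges of P.  The complement has at
   least k + 2 points when n >= 2k + 2, and a graph all of whose k-subsets span equally many edges
   is then complete or empty.  So P contains all pairs in the complement of a codeword as soon as it
   contains one of them, and by transitivity on C this holds for all codewords at once.  Finally,
   every pair of points is avoided by some codeword, because transitivity on points puts each point
   into |C| k / n < |C| / 2 codewords. *)
theory Submission
  imports Defs
begin

section \<open>Graphs in which all subsets of a given size span equally many edges\<close>

lemma eq_0_if_sums_over_subsets_0:
  fixes f :: "'a \<Rightarrow> 'b :: {idom, ring_char_0}"
  assumes "finite E" "0 < r" "r < card E"
    and sum_0: "\<And>S. S \<subseteq> E \<Longrightarrow> card S = r \<Longrightarrow> sum f S = 0"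
    and "u \<in> E"
  shows "f u = 0"
proof -
  have eq: "f v = f u" if "v \<in> E" for v
  proof (cases "v = u")
    case False
    \<comment> \<open>As \<open>r < card E\<close>, there is room for r - 1 points other than u and
      v. Completing them to an r-set once by u and once by v gives two vanishing sums that differ
      only in f u and f v.\<close>
    have "card (E - {u, v}) = card E - 2"
      using False that assms(1,5) by (subst card_Diff_subset) auto
    then obtain R where R: "R \<subseteq> E - {u, v}" "card R = r - 1"
      using assms(3) by (metis One_nat_def diff_le_mono less_eq_Suc_le numeral_2_eq_2
          diff_Suc_eq_diff_pred diff_Suc_1 obtain_subset_with_card_n)
    have "finite R"
      using R(1) assms(1) by (meson finite_Diff finite_subset)
    then have "sum f (insert w R) = f w + sum f R" "card (insert w R) = r" if "w \<in> {u, v}" for w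
    proof -
      have "w \<notin> R" using that R(1) by auto
      then show "sum f (insert w R) = f w + sum f R" "card (insert w R) = r"
        using \<open>finite R\<close> R(2) assms(2) by auto
    qed
    moreover have "insert w R \<subseteq> E" if "w \<in> {u, v}" for w
      using that R \<open>u \<in> E\<close> \<open>v \<in> E\<close> by auto
    ultimately have "f w + sum f R = 0" if "w \<in> {u, v}" for w
      using that sum_0 by metis
    then show ?thesis
      by (metis add_right_cancel insertI1 insertI2)
  qed simp
  \<comment> \<open>Now f is constant on E, so r * f u = 0, and the positive factor r cancels in an
    integral domain of characteristic 0.\<close>
  obtain S where S: "S \<subseteq> E" "card S = r"
    using assms(3) obtain_subset_with_card_n by (metis less_imp_le)
  then have "sum f S = (\<Sum>v\<in>S. f u)"
    using eq by (intro sum.cong) auto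
  with sum_0[OF S] S(2) assms(2) show ?thesis by simp
qed

text \<open>The new edges are those joining x to S. Their number is kept as a sum of indicators so
  that, for two vertices x and y, the sums can be subtracted term by term.\<close>

lemma card_edges_insert:
  assumes "finite S" "x \<notin> S" "P \<subseteq> {p. card p = 2}"
  shows "card {p \<in> P. p \<subseteq> insert x S} = card {p \<in> P. p \<subseteq> S} + (\<Sum>s\<in>S. of_bool ({x, s} \<in> P))"
proof -
  let ?N = "{s \<in> S. {x, s} \<in> P}"
  have "{p \<in> P. p \<subseteq> insert x S} = {p \<in> P. p \<subseteq> S} \<union> (\<lambda>s. {x, s}) ` ?N" (is "?L = ?R")
  proof
    show "?L \<subseteq> ?R"
    proof
      fix p assume p: "p \<in> ?L"
      then have "card p = 2" using assms(3) by auto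
      show "p \<in> ?R"
      proof (cases "x \<in> p")
        case True
        with \<open>card p = 2\<close> obtain s where "p = {x, s}" "s \<noteq> x"
          by (auto simp: card_2_iff)
        with p show ?thesis by auto
      qed (use p in auto)
    qed
  qed auto
  moreover have "card ({p \<in> P. p \<subseteq> S} \<union> (\<lambda>s. {x, s}) ` ?N)
      = card {p \<in> P. p \<subseteq> S} + card ((\<lambda>s. {x, s}) ` ?N)"
    using assms(1,2) by (intro card_Un_disjoint) auto
  moreover have "card ((\<lambda>s. {x, s}) ` ?N) = card ?N"
    by (intro card_image inj_onI) (auto simp: doubleton_eq_iff)
  ultimately show ?thesis
    using assms(1) by (simp add: Int_def)
qed

text \<open>Any two vertices x and y have the same neighbours elsewhere, because their adjacency
  indicators have equal sums over every (k - 1)-subset of \<open>D - {x, y}\<close>. By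
  \<open>k + 2 \<le> card D\<close> that set has at least k points, so an indicator difference with
  vanishing sums is zero. If D had only k + 1 points, the equal counts would merely say that the
  graph on D is regular.\<close>

lemma complete_if_subsets_equally_many_edges:
  assumes "finite D" "2 \<le> k" "k + 2 \<le> card D" "P \<subseteq> {p. card p = 2}"
    and const: "\<And>T. T \<subseteq> D \<Longrightarrow> card T = k \<Longrightarrow> card {p \<in> P. p \<subseteq> T} = c"
    and "p \<in> P" "p \<subseteq> D" "q \<subseteq> D" "card q = 2"
  shows "q \<in> P"
proof -
  (* Compare the edges spanned by insert x S and insert y S for (k - 1)-subsets S avoiding x and y. *)
  have swap: "{x, u} \<in> P \<longleftrightarrow> {y, u} \<in> P"
    if "x \<in> D" "y \<in> D" "u \<in> D" "x \<noteq> y" "u \<noteq> x" "u \<noteq> y" for x y u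
  proof -
    define f :: "'a \<Rightarrow> int" where "f s = of_bool ({x, s} \<in> P) - of_bool ({y, s} \<in> P)" for s
    have "card (D - {x, y}) = card D - 2"
      using that assms(1) by (subst card_Diff_subset) auto
    moreover have "sum f S = 0" if S: "S \<subseteq> D - {x, y}" "card S = k - 1" for S
    proof -
      have "finite S"
        using S(1) assms(1) by (meson finite_Diff finite_subset)
      moreover have "x \<notin> S" "y \<notin> S" using S by auto
      moreover have "insert x S \<subseteq> D" "insert y S \<subseteq> D"
        using S \<open>x \<in> D\<close> \<open>y \<in> D\<close> by auto
      ultimately have "(\<Sum>s\<in>S. of_bool ({x, s} \<in> P)) = (\<Sum>s\<in>S. of_bool ({y, s} \<in> P) :: nat)"
        using const[of "insert x S"] const[of "insert y S"] S(2) assms(2,4)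
          card_edges_insert[of S x P] card_edges_insert[of S y P] by simp
      then have "int (\<Sum>s\<in>S. of_bool ({x, s} \<in> P)) = int (\<Sum>s\<in>S. of_bool ({y, s} \<in> P))"
        by simp
      then show ?thesis
        by (simp add: f_def sum_subtractf del: sum_of_bool_eq)
    qed
    ultimately have "f u = 0"
      using assms(1-3) that
      by (intro eq_0_if_sums_over_subsets_0[where E = "D - {x, y}" and r = "k - 1" and f = f]) auto
    then show ?thesis by (auto simp: f_def split: if_splits)
  qed
  obtain a b where p: "p = {a, b}" "a \<noteq> b"
    using assms(4,6) by (auto simp: card_2_iff)
  obtain c d where q: "q = {c, d}" "c \<noteq> d"
    using assms(9) by (auto simp: card_2_iff)
  have D: "a \<in> D" "b \<in> D" "c \<in> D" "d \<in> D" and ab: "{a, b} \<in> P"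
    using p q assms(6-8) by auto
  \<comment> \<open>By \<open>swap\<close>, a vertex with one neighbour in D is joined to all other
    vertices of D. If a and c differ, the edge ab yields ac, and ac yields cd.\<close>
  have nbr: "{u, y} \<in> P" if "{u, x} \<in> P" "u \<in> D" "x \<in> D" "y \<in> D" "u \<noteq> x" "u \<noteq> y" for u x y
    using swap[of x y u] that by (cases "x = y") (auto simp: insert_commute)
  show ?thesis
  proof (cases "a = c")
    case True
    then show ?thesis using nbr[OF ab] D p q by auto
  next
    case False
    then have "{c, a} \<in> P" using nbr[OF ab, of c] D p by (simp add: insert_commute)
    then show ?thesis using nbr[of c a d] D q False by auto
  qed
qed

section \<open>Distances and the neighbours of a code\<close>

lemma graph_dist_le_1:
  assumes "pair_wf_digraph G" "(u, v) \<in> parcs G"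
  shows "graph_dist G u v \<le> 1"
proof -
  interpret pair_wf_digraph G by fact
  have "awalk u [(u, v)] v"
    using arc_implies_awalk[of "(u, v)"] assms(2) by simp
  from min_cost_le_walk_cost[OF this, of "\<lambda>_. 1"] show ?thesis
    by (simp add: graph_dist_def one_ereal_def)
qed

lemma graph_dist_ge_1:
  assumes "pair_wf_digraph G" "u \<noteq> v"
  shows "1 \<le> graph_dist G u v"
proof -
  interpret pair_wf_digraph G by fact
  \<comment> \<open>The distance is an infimum over walks, so each walk is bounded separately:
    between distinct vertices it has a first arc, of cost 1, and the remaining cost is
    nonnegative.\<close>
  have "1 \<le> ereal (awalk_cost (\<lambda>_. 1) p)" if "awalk u p v" for p
  proof (cases p)
    case Nil
    with that assms(2) show ?thesis by (simp add: awalk_Nil_iff)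
  next
    case (Cons e es)
    with that have "awalk (snd e) es v" by (simp add: awalk_Cons_iff)
    then have "0 \<le> awalk_cost (\<lambda>_. 1) es"
      by (rule pos_cost_pos_awalk_cost) simp
    with Cons show ?thesis by (simp add: one_ereal_def)
  qed
  then show ?thesis
    unfolding graph_dist_def \<mu>_def by (auto intro: INF_greatest)
qed

lemma min_distance_le:
  assumes "\<alpha> \<in> C" "\<beta> \<in> C" "\<alpha> \<noteq> \<beta>"
  shows "min_distance G C \<le> graph_dist G \<alpha> \<beta>"
  unfolding min_distance_def by (rule INF_lower2[of "(\<alpha>, \<beta>)"]) (use assms in auto)

text \<open>The vertex \<gamma> is no codeword, since it would be too close to \<alpha>. Hence every
  codeword has distance at least 1 from \<gamma>, and \<alpha> attains this bound.\<close>

lemma arc_into_code_neighbours: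
  assumes "pair_wf_digraph G" "1 < min_distance G C"
    and "\<alpha> \<in> C" "(\<alpha>, \<gamma>) \<in> parcs G" "\<alpha> \<noteq> \<gamma>"
  shows "\<gamma> \<in> code_neighbours G C"
proof -
  have "\<gamma> \<notin> C"
    using min_distance_le[of \<alpha> C \<gamma> G] graph_dist_le_1[OF assms(1,4)] assms(2,3,5) by force
  then have "1 \<le> (INF \<alpha>\<in>C. graph_dist G \<alpha> \<gamma>)"
    by (intro INF_greatest graph_dist_ge_1[OF assms(1)]) auto
  moreover have "(INF \<alpha>\<in>C. graph_dist G \<alpha> \<gamma>) \<le> 1"
    using assms(3) graph_dist_le_1[OF assms(1,4)] by (rule INF_lower2)
  moreover have "\<gamma> \<in> pverts G"
    using pair_wf_digraph.arc_snd_in_verts[OF assms(1,4)] by simp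
  ultimately show ?thesis
    by (auto simp: code_neighbours_def)
qed

section \<open>Induced actions on sets, and counting codewords through points\<close>

lemma group_action_on_sets:
  assumes "group_action G \<Omega> (\<lambda>g. g)" "X \<subseteq> Pow \<Omega>"
    and "\<And>g A. g \<in> carrier G \<Longrightarrow> A \<in> X \<Longrightarrow> g ` A \<in> X"
  shows "group_action G X (\<lambda>g. \<lambda>A\<in>X. g ` A)"
proof -
  interpret group_action G \<Omega> "\<lambda>g. g" by fact
  interpret G: group G
    using group_hom by (rule group_hom.axioms(1))
  have mult: "(g \<otimes>\<^bsub>G\<^esub> h) ` A = g ` h ` A"
    if "g \<in> carrier G" "h \<in> carrier G" "A \<in> X" for g h A
    unfolding image_image using that assms(2) composition_rule
    by (intro image_cong) blast+
  have "(\<one>\<^bsub>G\<^esub>) ` A = A" if "A \<in> X" for A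
  proof -
    have "(\<one>\<^bsub>G\<^esub>) ` A = (\<lambda>x. x) ` A"
      using that assms(2) by (intro image_cong) (auto simp flip: id_eq_one)
    then show ?thesis by simp
  qed
  then have inv1: "(inv\<^bsub>G\<^esub> g) ` g ` A = A" "g ` (inv\<^bsub>G\<^esub> g) ` A = A"
    if "g \<in> carrier G" "A \<in> X" for g A
    using that mult[of "inv\<^bsub>G\<^esub> g" g A] mult[of g "inv\<^bsub>G\<^esub> g" A] by simp_all
  \<comment> \<open>Invariance of X also holds for the inverse of g, which therefore supplies the
    inverse map on X.\<close>
  have bij: "(\<lambda>A\<in>X. g ` A) \<in> Bij X" if g: "g \<in> carrier G" for g
  proof -
    have "bij_betw (\<lambda>A\<in>X. g ` A) X X"
      by (rule bij_betw_byWitness[where f' = "\<lambda>A. (inv\<^bsub>G\<^esub> g) ` A"])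
        (use g inv1 assms(3) in auto)
    then show ?thesis by (simp add: Bij_def)
  qed
  show ?thesis
  proof (intro group_action.intro group_hom.intro group_hom_axioms.intro homI)
    show "group G" by (rule G.is_group)
    show "group (BijGroup X)" by (rule group_BijGroup)
    show "(\<lambda>A\<in>X. g ` A) \<in> carrier (BijGroup X)" if "g \<in> carrier G" for g
      using bij[OF that] by (simp add: BijGroup_def)
    show "(\<lambda>A\<in>X. (g \<otimes>\<^bsub>G\<^esub> h) ` A) = (\<lambda>A\<in>X. g ` A) \<otimes>\<^bsub>BijGroup X\<^esub> (\<lambda>A\<in>X. h ` A)"
      if "g \<in> carrier G" "h \<in> carrier G" for g h
      using that bij mult assms(3)
      by (auto simp: BijGroup_def compose_def fun_eq_iff)
  qed
qed

text \<open>A group element taking x to y permutes C, so it carries the codewords through x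
  bijectively to those through y.\<close>

lemma card_containing_constant:
  assumes "transitive_action G \<Omega> (\<lambda>g. g)" "C \<subseteq> Pow \<Omega>"
    and inv: "\<And>g. g \<in> carrier G \<Longrightarrow> (`) g ` C = C"
    and "x \<in> \<Omega>" "y \<in> \<Omega>"
  shows "card {\<alpha> \<in> C. x \<in> \<alpha>} = card {\<alpha> \<in> C. y \<in> \<alpha>}"
proof -
  interpret transitive_action G \<Omega> "\<lambda>g. g" by fact
  obtain g where g: "g \<in> carrier G" "g x = y"
    using unique_orbit assms(4,5) by blast
  have inj: "inj_on g \<Omega>" using inj_prop g(1) by simp
  have "bij_betw ((`) g) {\<alpha> \<in> C. x \<in> \<alpha>} {\<alpha> \<in> C. y \<in> \<alpha>}"
  proof (rule bij_betw_imageI)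
    show "inj_on ((`) g) {\<alpha> \<in> C. x \<in> \<alpha>}"
      by (rule inj_on_subset[OF inj_on_image_Pow[OF inj]]) (use assms(2) in auto)
    show "(`) g ` {\<alpha> \<in> C. x \<in> \<alpha>} = {\<alpha> \<in> C. y \<in> \<alpha>}"
    proof (intro equalityI subsetI)
      fix \<beta> assume \<beta>: "\<beta> \<in> {\<alpha> \<in> C. y \<in> \<alpha>}"
      then obtain \<alpha> where \<alpha>: "\<alpha> \<in> C" "\<beta> = g ` \<alpha>" using inv[OF g(1)] by blast
      then have "x \<in> \<alpha>"
        using \<beta> g(2) inj assms(2,4) by (auto dest: inj_onD)
      with \<alpha> show "\<beta> \<in> (`) g ` {\<alpha> \<in> C. x \<in> \<alpha>}" by blast
    qed (use g inv in auto)
  qed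
  then show ?thesis by (rule bij_betw_same_card)
qed

lemma ex_block_avoiding_two_points:
  assumes "finite \<Omega>" "transitive_action G \<Omega> (\<lambda>g. g)"
    and inv: "\<And>g. g \<in> carrier G \<Longrightarrow> (`) g ` C = C"
    and "C \<noteq> {}" "C \<subseteq> subsets_of_card \<Omega> k" "2 * k < card \<Omega>" "x \<in> \<Omega>" "y \<in> \<Omega>"
  obtains \<alpha> where "\<alpha> \<in> C" "x \<notin> \<alpha>" "y \<notin> \<alpha>"
proof -
  have C: "C \<subseteq> Pow \<Omega>" "\<And>\<alpha>. \<alpha> \<in> C \<Longrightarrow> card \<alpha> = k"
    using assms(5) by (auto simp: subsets_of_card_def)
  have fin: "finite C"
    using C(1) assms(1) by (meson finite_Pow_iff finite_subset)
  let ?r = "\<lambda>z. card {\<alpha> \<in> C. z \<in> \<alpha>}"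
  have const: "?r z = ?r x" if "z \<in> \<Omega>" for z
    using card_containing_constant[OF assms(2) C(1) inv that assms(7)] .
  \<comment> \<open>Count the incident pairs of a point and a codeword in two ways.\<close>
  have "card \<Omega> * ?r x = (\<Sum>z\<in>\<Omega>. ?r z)"
    using const by simp
  also have "\<dots> = k * card C"
  proof (rule sum_multicount[OF assms(1) fin], rule ballI)
    fix \<alpha> assume "\<alpha> \<in> C"
    then have "{z \<in> \<Omega>. z \<in> \<alpha>} = \<alpha>" using C(1) by auto
    with C(2) \<open>\<alpha> \<in> C\<close> show "card {z \<in> \<Omega>. z \<in> \<alpha>} = k" by simp
  qed
  finally have *: "card \<Omega> * ?r x = k * card C" .
  have "2 * ?r x < card C"
  proof (rule ccontr)
    assume ge: "\<not> 2 * ?r x < card C"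
    have "0 < card C" using assms(4) fin by (simp add: card_gt_0_iff)
    then have "2 * ?r x * (2 * k) < 2 * ?r x * card \<Omega>"
      using assms(6) ge by simp
    also have "\<dots> = card C * (2 * k)" using * by (simp add: ac_simps)
    also have "\<dots> \<le> 2 * ?r x * (2 * k)" using ge by simp
    finally show False by simp
  qed
  moreover have "card ({\<alpha> \<in> C. x \<in> \<alpha>} \<union> {\<alpha> \<in> C. y \<in> \<alpha>}) \<le> 2 * ?r x"
    using card_Un_le[of "{\<alpha> \<in> C. x \<in> \<alpha>}" "{\<alpha> \<in> C. y \<in> \<alpha>}"] const[OF assms(8)] by simp
  ultimately have "\<not> C \<subseteq> {\<alpha> \<in> C. x \<in> \<alpha>} \<union> {\<alpha> \<in> C. y \<in> \<alpha>}"
    using fin card_mono[of "{\<alpha> \<in> C. x \<in> \<alpha>} \<union> {\<alpha> \<in> C. y \<in> \<alpha>}" C] by auto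
  then show ?thesis using that by blast
qed

section \<open>Orbits of the automorphism group on pairs of points\<close>

theorem theorem1p4:
  fixes \<Omega> :: "'a set" and n k :: nat and C :: "'a set set"
  assumes "finite \<Omega>" and "card \<Omega> = n"
    and "2 \<le> k" and "real k \<le> (real n - 1) / 2"
    and "neighbour_transitive \<Omega> k C"
    and "3 \<le> min_distance (kneser \<Omega> k) C"
    and "transitive_on_points (code_aut \<Omega> C) \<Omega>"
  shows "n = 2 * k + 1 \<or> two_homogeneous (code_aut \<Omega> C) \<Omega>"
proof (rule disj_imp[THEN iffD2], rule impI)
  assume "n \<noteq> 2 * k + 1"
  moreover have "real (2 * k + 1) \<le> real n" using assms(4) by simp
  ultimately have n: "2 * k + 2 \<le> n" by linarith
  define G where "G = code_aut \<Omega> C"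
  define X where "X = subsets_of_card \<Omega> 2"
  define N where "N = code_neighbours (kneser \<Omega> k) C"
  have trans: "transitive_action G \<Omega> (\<lambda>g. g)"
    using assms(7) by (simp add: transitive_on_points_def G_def)
  interpret transitive_action G \<Omega> "\<lambda>g. g" by (rule trans)
  have inv: "(`) g ` C = C" if "g \<in> carrier G" for g
    using that by (simp add: G_def code_aut_def stabilizer_def)
  have code: "C \<subseteq> subsets_of_card \<Omega> k" "C \<noteq> {}"
    and trans_C: "transitive_action G C (\<lambda>g. \<lambda>A\<in>C. g ` A)"
    and trans_N: "transitive_action G N (\<lambda>g. \<lambda>A\<in>N. g ` A)"
    using assms(5)
    by (auto simp: neighbour_transitive_def is_code_def transitive_on_sets_def G_def N_def kneser_def)
  have image_X: "g ` A \<in> X" if "g \<in> carrier G" "A \<in> X" for g A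
    using that surj_prop[of g] card_image[OF inj_on_subset[OF inj_prop[of g]], of A]
    by (auto simp: X_def subsets_of_card_def)
  \<comment> \<open>Transitivity on pairs, as \<open>transitive_action\<close>, includes that the
    induced maps form a group action.\<close>
  have act_X: "group_action G X (\<lambda>g. \<lambda>A\<in>X. g ` A)"
    by (rule group_action_on_sets[OF group_action_axioms _ image_X]) (auto simp: X_def subsets_of_card_def)
  interpret X: group_action G X "\<lambda>g. \<lambda>A\<in>X. g ` A" by (rule act_X)
  have wf: "pair_wf_digraph (kneser \<Omega> k)"
    by (rule pair_wf_digraph.intro) (auto simp: kneser_def)
  have dist: "1 < min_distance (kneser \<Omega> k) C"
    by (rule less_le_trans[OF _ assms(6)]) simp
  have N: "T \<in> N" if "\<alpha> \<in> C" "T \<subseteq> \<Omega> - \<alpha>" "card T = k" for \<alpha> T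
  proof -
    have "(\<alpha>, T) \<in> parcs (kneser \<Omega> k)"
      using that code by (auto simp: kneser_def subsets_of_card_def)
    moreover have "\<alpha> \<noteq> T"
    proof
      assume "\<alpha> = T"
      with that(2) have "T = {}" by blast
      with that(3) assms(3) show False by simp
    qed
    ultimately show ?thesis
      unfolding N_def using that(1) by (intro arc_into_code_neighbours[OF wf dist]) auto
  qed
  have avoid: "\<exists>\<alpha>\<in>C. p \<subseteq> \<Omega> - \<alpha>" if "p \<in> X" for p
  proof -
    have "card p = 2" using that by (simp add: X_def subsets_of_card_def)
    then obtain x y where p: "p = {x, y}" by (meson card_2_iff)
    then have xy: "x \<in> \<Omega>" "y \<in> \<Omega>"
      using that by (auto simp: X_def subsets_of_card_def)
    have "2 * k < card \<Omega>" using n assms(2) by simp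
    then obtain \<alpha> where "\<alpha> \<in> C" "x \<notin> \<alpha>" "y \<notin> \<alpha>"
      using ex_block_avoiding_two_points[OF assms(1) trans inv code(2,1) _ xy] by blast
    with p xy show ?thesis by blast
  qed
  have same: "\<exists>g\<in>carrier G. g ` p = q" if pq: "p \<in> X" "q \<in> X" for p q
  proof -
    define P where "P = {g ` p | g. g \<in> carrier G}"
    have P: "P \<subseteq> X" using image_X pq(1) by (auto simp: P_def)
    have closed: "g ` e \<in> P" if g: "g \<in> carrier G" and "e \<in> P" for g e
    proof -
      obtain h where h: "h \<in> carrier G" "e = h ` p"
        using \<open>e \<in> P\<close> by (auto simp: P_def)
      have "(g \<otimes>\<^bsub>G\<^esub> h) ` p = g ` e"
        using X.composition_rule[OF pq(1) g h(1)] image_X[OF h(1) pq(1)] pq(1) h(2) by simp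
      moreover have "g \<otimes>\<^bsub>G\<^esub> h \<in> carrier G"
        using g h(1) group_hom by (meson group_hom.axioms(1) group.is_monoid monoid.m_closed)
      ultimately show ?thesis unfolding P_def by blast
    qed
    have "p \<in> P"
    proof -
      have "(\<one>\<^bsub>G\<^esub>) ` p = p"
        using X.id_eq_one pq(1) by (metis restrict_apply')
      moreover have "\<one>\<^bsub>G\<^esub> \<in> carrier G"
        using group_hom by (meson group_hom.axioms(1) group.is_monoid monoid.one_closed)
      ultimately show ?thesis unfolding P_def by blast
    qed
    \<comment> \<open>An element taking S to T maps the edges inside S injectively to edges inside
      T, as P is an orbit. Exchanging S and T will give equality.\<close>
    have le: "card {e \<in> P. e \<subseteq> S} \<le> card {e \<in> P. e \<subseteq> T}" if ST: "S \<in> N" "T \<in> N" for S T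
    proof -
      obtain g where g: "g \<in> carrier G" "g ` S = T"
        using transitive_action.unique_orbit[OF trans_N ST] ST(1) by auto
      have sub: "{e \<in> P. e \<subseteq> S} \<subseteq> Pow \<Omega>" "{e \<in> P. e \<subseteq> T} \<subseteq> Pow \<Omega>"
        using P by (auto simp: X_def subsets_of_card_def)
      have "inj_on g \<Omega>" using inj_prop g(1) .
      from inj_on_subset[OF inj_on_image_Pow[OF this] sub(1)]
      have "inj_on ((`) g) {e \<in> P. e \<subseteq> S}" .
      moreover have "(`) g ` {e \<in> P. e \<subseteq> S} \<subseteq> {e \<in> P. e \<subseteq> T}"
        using closed[OF g(1)] g(2) by auto
      moreover have "finite {e \<in> P. e \<subseteq> T}"
        using sub(2) assms(1) by (meson finite_Pow_iff finite_subset)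
      ultimately show ?thesis by (rule card_inj_on_le)
    qed
    \<comment> \<open>The pairs p and q may avoid different codewords. Moving \<alpha> to \<beta>
      replaces p by another edge of P that lies in the same complement as q, where the completeness
      lemma applies.\<close>
    obtain \<alpha> \<beta> where \<alpha>: "\<alpha> \<in> C" "p \<subseteq> \<Omega> - \<alpha>" and \<beta>: "\<beta> \<in> C" "q \<subseteq> \<Omega> - \<beta>"
      using avoid pq by meson
    obtain g where g: "g \<in> carrier G" "g ` \<alpha> = \<beta>"
      using transitive_action.unique_orbit[OF trans_C \<alpha>(1) \<beta>(1)] \<alpha>(1) by auto
    have "\<alpha> \<subseteq> \<Omega>" "\<beta> \<subseteq> \<Omega>" "card \<beta> = k"
      using \<alpha>(1) \<beta>(1) code(1) by (auto simp: subsets_of_card_def)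
    have "g ` p \<subseteq> g ` (\<Omega> - \<alpha>)" using \<alpha>(2) by blast
    also have "\<dots> = \<Omega> - \<beta>"
      using inj_on_image_set_diff[OF inj_prop[OF g(1)], of \<Omega> \<alpha>] surj_prop[OF g(1)] g(2) \<open>\<alpha> \<subseteq> \<Omega>\<close>
      by auto
    finally have gp: "g ` p \<subseteq> \<Omega> - \<beta>" .
    have "card (\<Omega> - \<beta>) = n - k"
      using \<open>\<beta> \<subseteq> \<Omega>\<close> \<open>card \<beta> = k\<close> assms(1,2) by (metis card_Diff_subset finite_subset)
    \<comment> \<open>Here the odd graphs are excluded: for n = 2k + 1 the complement would have
      only k + 1 points.\<close>
    then have card: "k + 2 \<le> card (\<Omega> - \<beta>)" using n by simp
    then obtain T\<^sub>0 where T\<^sub>0: "T\<^sub>0 \<subseteq> \<Omega> - \<beta>" "card T\<^sub>0 = k"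
      by (metis add_leD1 obtain_subset_with_card_n)
    have const: "card {e \<in> P. e \<subseteq> T} = card {e \<in> P. e \<subseteq> T\<^sub>0}"
      if "T \<subseteq> \<Omega> - \<beta>" "card T = k" for T
      using N[OF \<beta>(1) that] N[OF \<beta>(1) T\<^sub>0] le by (intro antisym) simp_all
    have "q \<in> P"
    proof (rule complete_if_subsets_equally_many_edges)
      show "finite (\<Omega> - \<beta>)" using assms(1) by simp
      show "P \<subseteq> {e. card e = 2}" "card q = 2"
        using P pq(2) by (auto simp: X_def subsets_of_card_def)
      show "g ` p \<in> P" using closed g(1) \<open>p \<in> P\<close> .
      show "card {e \<in> P. e \<subseteq> T} = card {e \<in> P. e \<subseteq> T\<^sub>0}"
        if "T \<subseteq> \<Omega> - \<beta>" "card T = k" for T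
        using const that .
    qed (use assms(3) card gp \<beta>(2) in simp_all)
    then show ?thesis by (auto simp: P_def)
  qed
  then have "transitive_action G X (\<lambda>g. \<lambda>A\<in>X. g ` A)"
    by (intro transitive_action.intro act_X transitive_action_axioms.intro) auto
  then show "two_homogeneous (code_aut \<Omega> C) \<Omega>"
    by (simp add: two_homogeneous_def transitive_on_sets_def G_def X_def)
qed

end
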